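(* Let $R$ be a commutative ring, $A$ a commutative $R$-algebra, and $M$ a left $A$-module equipped with the structure of a commutative $R$-algebra. Let $\mu\in R$ and $E\in M$ be such that $M$ is $\mu$-torsion-free, $E\equiv1$ modulo $\mu$, and $TE\equiv ET$ modulo $\mu$ for all $T\in A$. Then, for each positive integer $n$ and each prime number $p$ which divides $\mu$ in $R$, the function $\phi_n^E:A\to\operatorname{Hom}_R(M,M)$ given by $\phi_n^E(T)=\Delta_nT$ is a Hochschild $1$-cocycle.
   Context: In $TE\equiv ET$, the element $T\in A$ is regarded as the endomorphism of $M$ given by its action and $E$ as the endomorphism $e$ of $M$ given by multiplication by $E$; the congruence means that $T\circ e-e\circ T\in\mu\operatorname{Hom}_R(M,M)$. For $T\in A$, $\Delta_nT\in\operatorname{Hom}_R(M,M)$ is the unique element with $p^{\nu_p(n)}\Delta_nT=D_nT$, where $D_nT=\sum_{i=1}^n\binom ni e^{n-i}\mu^{-1}(\mu\delta)^i(T)$ and $(\mu\delta)(S)=S\circ e-e\circ S$ for $S\in\operatorname{Hom}_R(M,M)$ (so $(\mu\delta)^i$ is the $i$-fold iterate, and division by $\mu$ is possible and unique under the hypotheses); $\nu_p$ is $p$-adic valuation on integers. Equivalently, $\mu\,p^{\nu_p(n)}\Delta_nT=T\circ e^n-e^n\circ T$. $\operatorname{Hom}_R(M,M)$ is an $A$-bimodule with left action by post-composition and right action by pre-composition. A Hochschild $1$-cocycle $\phi:A\to B$ with values in an $A$-bimodule $B$ is an $R$-linear map with $a_0\phi(a_1)-\phi(a_0a_1)+\phi(a_0)a_1=0$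 for all $a_0,a_1\in A$. *)

theory Defs
  imports
    "HOL-Algebra.Module"
    "HOL-Algebra.Divisibility"
    "HOL-Library.FuncSet"
    "HOL-Computational_Algebra.Primes"
begin

text \<open>
  A record has only one field for scalar multiplication. Where an abelian group \<open>M\<close> is a module
  over two rings, the record \<open>M\<close> holds the first action and the second is a separate function
  \<open>act\<close>; this is the module that results from the second action.
\<close>

definition with_action :: "('r, 'm) module \<Rightarrow> ('a \<Rightarrow> 'm \<Rightarrow> 'm) \<Rightarrow> ('a, 'm) module" where
  "with_action M act =
     \<lparr>carrier = carrier M, monoid.mult = monoid.mult M, one = one M, zero = zero M, add = add M, smult = act\<rparr>"

text \<open>
  The compatibility condition says that the \<open>R\<close>-module structure of \<open>M\<close> is the one obtained from
  the \<open>A\<close>-module structure along the structure map of the \<open>R\<close>-algebra \<open>A\<close>. Nothing relates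
  the action of \<open>A\<close> to the multiplication of \<open>M\<close>.
\<close>

definition compatible_left_module ::
    "'r ring \<Rightarrow> ('r, 'a) module \<Rightarrow> ('r, 'm) module \<Rightarrow> ('a \<Rightarrow> 'm \<Rightarrow> 'm) \<Rightarrow> bool" where
  "compatible_left_module R A M act \<longleftrightarrow>
     Module.module A (with_action M act) \<and>
     (\<forall>r\<in>carrier R. \<forall>a\<in>carrier A. \<forall>m\<in>carrier M. act (r \<odot>\<^bsub>A\<^esub> a) m = r \<odot>\<^bsub>M\<^esub> act a m)"

text \<open>
  Linear maps are taken to be \<open>undefined\<close> outside \<open>carrier M\<close>, so that equality of functions is
  equality of linear maps.
\<close>

definition module_Hom :: "'r ring \<Rightarrow> ('r, 'm) module \<Rightarrow> ('r, 'm \<Rightarrow> 'm) module" where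
  "module_Hom R M =
     \<lparr>carrier = {f \<in> carrier M \<rightarrow>\<^sub>E carrier M.
         (\<forall>x\<in>carrier M. \<forall>y\<in>carrier M. f (x \<oplus>\<^bsub>M\<^esub> y) = f x \<oplus>\<^bsub>M\<^esub> f y) \<and>
         (\<forall>r\<in>carrier R. \<forall>x\<in>carrier M. f (r \<odot>\<^bsub>M\<^esub> x) = r \<odot>\<^bsub>M\<^esub> f x)},
      monoid.mult = compose (carrier M),
      one = (\<lambda>x\<in>carrier M. x),
      zero = (\<lambda>x\<in>carrier M. \<zero>\<^bsub>M\<^esub>),
      add = (\<lambda>f g. \<lambda>x\<in>carrier M. f x \<oplus>\<^bsub>M\<^esub> g x),
      smult = (\<lambda>r f. \<lambda>x\<in>carrier M. r \<odot>\<^bsub>M\<^esub> f x)\<rparr>"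

definition torsion_free_wrt :: "'r \<Rightarrow> ('r, 'm) module \<Rightarrow> bool" where
  "torsion_free_wrt \<mu> N \<longleftrightarrow> (\<forall>x\<in>carrier N. \<mu> \<odot>\<^bsub>N\<^esub> x = \<zero>\<^bsub>N\<^esub> \<longrightarrow> x = \<zero>\<^bsub>N\<^esub>)"

definition congruent_modulo :: "'r \<Rightarrow> ('r, 'm) module \<Rightarrow> 'm \<Rightarrow> 'm \<Rightarrow> bool" where
  "congruent_modulo \<mu> N x y \<longleftrightarrow> (\<exists>z\<in>carrier N. x \<ominus>\<^bsub>N\<^esub> y = \<mu> \<odot>\<^bsub>N\<^esub> z)"

definition action_map :: "('r, 'm) module \<Rightarrow> ('a \<Rightarrow> 'm \<Rightarrow> 'm) \<Rightarrow> 'a \<Rightarrow> 'm \<Rightarrow> 'm" where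
  "action_map M act T = (\<lambda>m\<in>carrier M. act T m)"

definition mult_map :: "('r, 'm) module \<Rightarrow> 'm \<Rightarrow> 'm \<Rightarrow> 'm" where
  "mult_map M E = (\<lambda>m\<in>carrier M. E \<otimes>\<^bsub>M\<^esub> m)"

text \<open>
  \<open>mu_delta\<close> is the operator \<open>\<mu>\<delta>\<close> as a whole, which does not involve the value of \<open>\<mu>\<close>.
\<close>

definition mu_delta :: "'r ring \<Rightarrow> ('r, 'm) module \<Rightarrow> 'm \<Rightarrow> ('m \<Rightarrow> 'm) \<Rightarrow> ('m \<Rightarrow> 'm)" where
  "mu_delta R M E S =
     (S \<otimes>\<^bsub>module_Hom R M\<^esub> mult_map M E) \<ominus>\<^bsub>module_Hom R M\<^esub> (mult_map M E \<otimes>\<^bsub>module_Hom R M\<^esub> S)"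

text \<open>
  The descriptions in \<open>divide_by\<close> and \<open>Delta\<close> carry no information unless the quotient exists and
  is unique in the module.
\<close>

definition divide_by :: "'r \<Rightarrow> ('r, 'm) module \<Rightarrow> 'm \<Rightarrow> 'm" where
  "divide_by \<mu> N y = (THE x. x \<in> carrier N \<and> \<mu> \<odot>\<^bsub>N\<^esub> x = y)"

definition D_op ::
    "'r ring \<Rightarrow> ('r, 'm) module \<Rightarrow> ('a \<Rightarrow> 'm \<Rightarrow> 'm) \<Rightarrow> 'r \<Rightarrow> 'm \<Rightarrow> nat \<Rightarrow> 'a \<Rightarrow> ('m \<Rightarrow> 'm)" where
  "D_op R M act \<mu> E n T =
     (\<Oplus>\<^bsub>module_Hom R M\<^esub> i\<in>{1..n}.
        [(n choose i)] \<cdot>\<^bsub>module_Hom R M\<^esub>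
          ((mult_map M E [^]\<^bsub>module_Hom R M\<^esub> (n - i)) \<otimes>\<^bsub>module_Hom R M\<^esub>
           divide_by \<mu> (module_Hom R M) ((mu_delta R M E ^^ i) (action_map M act T))))"

definition Delta ::
    "'r ring \<Rightarrow> ('r, 'm) module \<Rightarrow> ('a \<Rightarrow> 'm \<Rightarrow> 'm) \<Rightarrow> 'r \<Rightarrow> 'm \<Rightarrow> nat \<Rightarrow> nat \<Rightarrow> 'a \<Rightarrow> ('m \<Rightarrow> 'm)" where
  "Delta R M act \<mu> E p n T =
     (THE X. X \<in> carrier (module_Hom R M) \<and>
        [(p ^ multiplicity p n)] \<cdot>\<^bsub>module_Hom R M\<^esub> X = D_op R M act \<mu> E n T)"

text \<open>
  Here \<open>B\<close> is an \<open>R\<close>-module with a left action \<open>lact\<close> and a right action \<open>ract\<close> of \<open>A\<close>;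
  \<open>ract b a\<close> is \<open>b\<close> acted on by \<open>a\<close>.
\<close>

definition hochschild_1_cocycle ::
    "'r ring \<Rightarrow> ('r, 'a) module \<Rightarrow> ('r, 'b) module \<Rightarrow> ('a \<Rightarrow> 'b \<Rightarrow> 'b) \<Rightarrow> ('b \<Rightarrow> 'a \<Rightarrow> 'b) \<Rightarrow>
      ('a \<Rightarrow> 'b) \<Rightarrow> bool" where
  "hochschild_1_cocycle R A B lact ract \<phi> \<longleftrightarrow>
     \<phi> \<in> carrier A \<rightarrow> carrier B \<and>
     (\<forall>a\<in>carrier A. \<forall>b\<in>carrier A. \<phi> (a \<oplus>\<^bsub>A\<^esub> b) = \<phi> a \<oplus>\<^bsub>B\<^esub> \<phi> b) \<and>
     (\<forall>r\<in>carrier R. \<forall>a\<in>carrier A. \<phi> (r \<odot>\<^bsub>A\<^esub> a) = r \<odot>\<^bsub>B\<^esub> \<phi> a) \<and>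
     (\<forall>a\<^sub>0\<in>carrier A. \<forall>a\<^sub>1\<in>carrier A.
        (lact a\<^sub>0 (\<phi> a\<^sub>1) \<ominus>\<^bsub>B\<^esub> \<phi> (a\<^sub>0 \<otimes>\<^bsub>A\<^esub> a\<^sub>1)) \<oplus>\<^bsub>B\<^esub> ract (\<phi> a\<^sub>0) a\<^sub>1 = \<zero>\<^bsub>B\<^esub>)"

definition post_comp ::
    "'r ring \<Rightarrow> ('r, 'm) module \<Rightarrow> ('a \<Rightarrow> 'm \<Rightarrow> 'm) \<Rightarrow> 'a \<Rightarrow> ('m \<Rightarrow> 'm) \<Rightarrow> ('m \<Rightarrow> 'm)" where
  "post_comp R M act a S = action_map M act a \<otimes>\<^bsub>module_Hom R M\<^esub> S"

definition pre_comp ::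
    "'r ring \<Rightarrow> ('r, 'm) module \<Rightarrow> ('a \<Rightarrow> 'm \<Rightarrow> 'm) \<Rightarrow> ('m \<Rightarrow> 'm) \<Rightarrow> 'a \<Rightarrow> ('m \<Rightarrow> 'm)" where
  "pre_comp R M act S a = S \<otimes>\<^bsub>module_Hom R M\<^esub> action_map M act a"

end

theory Submission
  imports Defs
begin

text \<open>
  For a fixed \<open>e\<close>, the map sending \<open>S\<close> to \<open>S e\<^sup>n - e\<^sup>n S\<close> is an inner derivation of the ring of
  endomorphisms of \<open>M\<close>, hence satisfies the cocycle identity. The theorem says that on \<open>A\<close> this
  derivation can be divided by \<open>c = \<mu> p\<^sup>v\<close>, where \<open>v\<close> is the \<open>p\<close>-adic valuation of \<open>n\<close>. The quotient is
  again a cocycle: \<open>c\<close> times each identity that is wanted is the corresponding identity of the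
  derivation, and \<open>c\<close> can be cancelled, because \<open>p\<close> divides \<open>\<mu>\<close> and so every power of \<open>p\<close> is
  cancellable along with \<open>\<mu>\<close>. This is \<open>divided_inner_derivation_cocycle\<close>.

  What remains is that \<open>\<mu> p\<^sup>v \<Delta>\<^sub>nT = T e\<^sup>n - e\<^sup>n T\<close> with a well-defined \<open>\<Delta>\<^sub>nT\<close>. Right multiplication by
  \<open>e\<close> is the sum of left multiplication by \<open>e\<close> and of \<open>\<mu>\<delta>\<close>, and these two operators commute; the
  binomial theorem (\<open>mult_power_binomial\<close>) therefore gives \<open>\<mu> D\<^sub>nT = T e\<^sup>n - e\<^sup>n T\<close>
  (\<open>smult_commutator_quotient\<close>). For the divisibility of \<open>D\<^sub>nT\<close> by \<open>p\<^sup>v\<close>, write \<open>e = 1 + \<mu> f\<close>. A commutator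
  with \<open>e\<close> is \<open>\<mu>\<close> times a commutator with \<open>f\<close>, and the first commutator \<open>T e - e T\<close> is divisible by \<open>\<mu>\<close>
  by hypothesis, so \<open>(\<mu>\<delta>)\<^sup>i(T)\<close> is divisible by \<open>\<mu>\<^sup>i\<close> (\<open>ad_funpow_eq_smult\<close>). After division by one factor \<open>\<mu>\<close>
  the \<open>i\<close>-th term of \<open>D\<^sub>nT\<close> is a multiple of \<open>\<mu>\<^sup>i\<^sup>-\<^sup>1\<close> times the binomial coefficient of \<open>n\<close> over \<open>i\<close>, hence of
  \<open>p\<^sup>i\<^sup>-\<^sup>1\<close> times that coefficient, and this integer is divisible by \<open>p\<^sup>v\<close>
  (\<open>prime_power_dvd_binomial_times_power\<close>, \<open>commutator_quotient_divisible\<close>).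

  All of this takes place in an arbitrary associative algebra, and only at the end is the algebra
  specialised to the endomorphisms of \<open>M\<close>.
\<close>

section \<open>Divisibility of binomial coefficients\<close>

text \<open>
  From \<open>i * (n choose i) = n * (n - 1 choose i - 1)\<close>, the coefficient can lack at most as many factors \<open>p\<close>
  of \<open>n\<close> as \<open>i\<close> contains; if that number is \<open>a\<close>, then \<open>a < p\<^sup>a \<le> i\<close>, so \<open>p\<^sup>i\<^sup>-\<^sup>1\<close> makes up for them.
\<close>

lemma prime_power_dvd_binomial_times_power:
  fixes p n i :: nat
  assumes p: "Factorial_Ring.prime p" and i: "i > 0"
  shows "p ^ multiplicity p n dvd (n choose i) * p ^ (i - 1)"
proof -
  obtain j where j: "i = p ^ multiplicity p i * j" "\<not> p dvd j"
    using multiplicity_decompose'[of i p] i p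
    by (metis Factorial_Ring.prime_def not_prime_unit not_gr_zero)
  define a where "a = multiplicity p i"
  have "p ^ multiplicity p n dvd i * (n choose i)"
    unfolding times_binomial_minus1_eq[OF i] by (intro dvd_mult2 multiplicity_dvd)
  then have "p ^ multiplicity p n dvd (p ^ a * (n choose i)) * j"
    using j(1) unfolding a_def by (metis mult.assoc mult.commute)
  moreover have "coprime (p ^ multiplicity p n) j"
    using p j(2) by (simp add: prime_imp_coprime)
  ultimately have *: "p ^ multiplicity p n dvd p ^ a * (n choose i)"
    by (simp add: coprime_dvd_mult_left_iff)
  have "p ^ a \<le> i"
    using i unfolding a_def by (intro dvd_imp_le multiplicity_dvd)
  moreover have "a < p ^ a"
    using p by (intro power_gt_expt) (auto simp: prime_gt_Suc_0_nat prime_gt_1_nat)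
  ultimately have "a \<le> i - 1"
    by simp
  then have "p ^ a * (n choose i) dvd (n choose i) * p ^ (i - 1)"
    by (simp add: le_imp_power_dvd mult.commute mult_dvd_mono)
  with * show ?thesis
    by (rule dvd_trans)
qed

section \<open>Cancelling and dividing by scalars\<close>

lemma (in ring) add_pow_one_mult:
  fixes j k :: nat
  shows "[(j * k)] \<cdot> \<one> = ([j] \<cdot> \<one>) \<otimes> ([k] \<cdot> \<one>)"
  by (simp add: add_pow_ldistr add.nat_pow_pow mult.commute)

lemma (in ring) add_pow_one_power:
  fixes j k :: nat
  shows "[(j ^ k)] \<cdot> \<one> = ([j] \<cdot> \<one>) [^] k"
  by (induction k) (simp_all add: add_pow_one_mult power_Suc2 del: power_Suc)

context module
begin

lemma add_pow_eq_smult: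
  fixes k :: nat
  assumes "x \<in> carrier M"
  shows "[k] \<cdot>\<^bsub>M\<^esub> x = ([k] \<cdot>\<^bsub>R\<^esub> \<one>\<^bsub>R\<^esub>) \<odot>\<^bsub>M\<^esub> x"
  using assms by (induction k) (simp_all add: smult_l_distr)

lemma smult_minus_distr:
  assumes "a \<in> carrier R" "x \<in> carrier M" "y \<in> carrier M"
  shows "a \<odot>\<^bsub>M\<^esub> (x \<ominus>\<^bsub>M\<^esub> y) = a \<odot>\<^bsub>M\<^esub> x \<ominus>\<^bsub>M\<^esub> a \<odot>\<^bsub>M\<^esub> y"
  using assms by (simp add: M.minus_eq smult_r_distr smult_r_minus)

lemma smult_left_commute:
  assumes "r \<in> carrier R" "s \<in> carrier R" "x \<in> carrier M"
  shows "r \<odot>\<^bsub>M\<^esub> (s \<odot>\<^bsub>M\<^esub> x) = s \<odot>\<^bsub>M\<^esub> (r \<odot>\<^bsub>M\<^esub> x)"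
  using assms by (simp add: smult_assoc1[symmetric] R.m_comm)

end

context
  fixes R :: "'r ring" and M :: "('r, 'm) module"
  assumes M: "module R M"
begin

interpretation module R M by (rule M)

lemma torsion_freeD:
  "\<lbrakk>torsion_free_wrt a M; x \<in> carrier M; a \<odot>\<^bsub>M\<^esub> x = \<zero>\<^bsub>M\<^esub>\<rbrakk> \<Longrightarrow> x = \<zero>\<^bsub>M\<^esub>"
  unfolding torsion_free_wrt_def by blast

lemma torsion_free_cancel:
  assumes "torsion_free_wrt a M" "a \<in> carrier R" "x \<in> carrier M" "y \<in> carrier M"
    and eq: "a \<odot>\<^bsub>M\<^esub> x = a \<odot>\<^bsub>M\<^esub> y"
  shows "x = y"
proof -
  have "a \<odot>\<^bsub>M\<^esub> (x \<ominus>\<^bsub>M\<^esub> y) = \<zero>\<^bsub>M\<^esub>"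
    unfolding smult_minus_distr[OF assms(2-4)] eq
    using assms(2,4) by (simp add: M.minus_eq M.r_neg)
  then have "x \<ominus>\<^bsub>M\<^esub> y = \<zero>\<^bsub>M\<^esub>"
    by (intro torsion_freeD[OF assms(1) _ \<open>a \<odot>\<^bsub>M\<^esub> (x \<ominus>\<^bsub>M\<^esub> y) = \<zero>\<^bsub>M\<^esub>\<close>] M.minus_closed assms)
  then have "(x \<ominus>\<^bsub>M\<^esub> y) \<oplus>\<^bsub>M\<^esub> y = \<zero>\<^bsub>M\<^esub> \<oplus>\<^bsub>M\<^esub> y"
    by simp
  then show ?thesis
    using assms(3,4) by (simp add: M.minus_eq M.a_assoc M.l_neg)
qed

lemma torsion_free_mult:
  assumes "torsion_free_wrt a M" "torsion_free_wrt b M" "a \<in> carrier R" "b \<in> carrier R"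
  shows "torsion_free_wrt (a \<otimes>\<^bsub>R\<^esub> b) M"
  unfolding torsion_free_wrt_def
proof safe
  fix x assume x: "x \<in> carrier M" "(a \<otimes>\<^bsub>R\<^esub> b) \<odot>\<^bsub>M\<^esub> x = \<zero>\<^bsub>M\<^esub>"
  have "b \<odot>\<^bsub>M\<^esub> x = \<zero>\<^bsub>M\<^esub>"
    by (rule torsion_freeD[OF assms(1)]) (use assms(3,4) x in \<open>simp_all add: smult_assoc1\<close>)
  with assms(2) x(1) show "x = \<zero>\<^bsub>M\<^esub>"
    by (rule torsion_freeD)
qed

lemma torsion_free_power:
  fixes k :: nat
  assumes "torsion_free_wrt a M" "a \<in> carrier R"
  shows "torsion_free_wrt (a [^]\<^bsub>R\<^esub> k) M"
proof (induction k)
  case 0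
  show ?case by (simp add: torsion_free_wrt_def)
next
  case (Suc k)
  then show ?case using torsion_free_mult[OF Suc assms(1)] assms(2) by simp
qed

lemma torsion_free_divides:
  assumes "torsion_free_wrt a M" "b divides\<^bsub>R\<^esub> a" "b \<in> carrier R"
  shows "torsion_free_wrt b M"
  unfolding torsion_free_wrt_def
proof safe
  fix x assume x: "x \<in> carrier M" "b \<odot>\<^bsub>M\<^esub> x = \<zero>\<^bsub>M\<^esub>"
  obtain c where c: "c \<in> carrier R" "a = b \<otimes>\<^bsub>R\<^esub> c"
    using assms(2) by (auto simp: factor_def)
  have "a \<odot>\<^bsub>M\<^esub> x = c \<odot>\<^bsub>M\<^esub> (b \<odot>\<^bsub>M\<^esub> x)"
    unfolding c(2) R.m_comm[OF assms(3) c(1)] using c(1) assms(3) x(1) by (rule smult_assoc1)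
  also have "\<dots> = \<zero>\<^bsub>M\<^esub>"
    using x c(1) by simp
  finally show "x = \<zero>\<^bsub>M\<^esub>"
    by (rule torsion_freeD[OF assms(1) x(1)])
qed

lemma divide_by_smult:
  assumes "torsion_free_wrt a M" "a \<in> carrier R" "x \<in> carrier M"
  shows "divide_by a M (a \<odot>\<^bsub>M\<^esub> x) = x"
  unfolding divide_by_def
proof (rule the_equality)
  show "x \<in> carrier M \<and> a \<odot>\<^bsub>M\<^esub> x = a \<odot>\<^bsub>M\<^esub> x"
    using assms(3) by blast
  fix y assume "y \<in> carrier M \<and> a \<odot>\<^bsub>M\<^esub> y = a \<odot>\<^bsub>M\<^esub> x"
  then show "y = x"
    by (elim conjE) (rule torsion_free_cancel[OF assms(1,2) _ assms(3)])
qed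

end

section \<open>Commutators in associative algebras\<close>

text \<open>
  The multiplication of \<open>H\<close> is not required to commute, since \<open>H\<close> stands for an endomorphism ring; the
  scalars must then be allowed to move out of either factor.
\<close>

locale assoc_algebra = module R H + H?: ring H for R :: "'r ring" and H :: "('r, 'h) module" (structure) +
  assumes smult_mult_left:
      "\<lbrakk>r \<in> carrier R; x \<in> carrier H; y \<in> carrier H\<rbrakk> \<Longrightarrow> (r \<odot> x) \<otimes> y = r \<odot> (x \<otimes> y)"
    and smult_mult_right:
      "\<lbrakk>r \<in> carrier R; x \<in> carrier H; y \<in> carrier H\<rbrakk> \<Longrightarrow> x \<otimes> (r \<odot> y) = r \<odot> (x \<otimes> y)"
begin

lemmas torsion_free_cancel = torsion_free_cancel[OF module_axioms]
  and torsion_free_mult = torsion_free_mult[OF module_axioms]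
  and torsion_free_power = torsion_free_power[OF module_axioms]
  and torsion_free_divides = torsion_free_divides[OF module_axioms]
  and divide_by_smult = divide_by_smult[OF module_axioms]

definition ad :: "'h \<Rightarrow> 'h \<Rightarrow> 'h" where
  "ad e x = x \<otimes> e \<ominus> e \<otimes> x"

lemma ad_closed [simp, intro]:
  "\<lbrakk>e \<in> carrier H; x \<in> carrier H\<rbrakk> \<Longrightarrow> ad e x \<in> carrier H"
  by (simp add: ad_def)

lemma ad_funpow_closed [simp, intro]:
  "\<lbrakk>e \<in> carrier H; x \<in> carrier H\<rbrakk> \<Longrightarrow> (ad e ^^ i) x \<in> carrier H"
  by (induction i) auto

lemma mult_eq_mult_ad:
  assumes "e \<in> carrier H" "x \<in> carrier H"
  shows "x \<otimes> e = e \<otimes> x \<oplus> ad e x"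
proof -
  have "e \<otimes> x \<oplus> ad e x = x \<otimes> e \<oplus> (e \<otimes> x \<oplus> \<ominus> (e \<otimes> x))"
    unfolding ad_def M.minus_eq using assms by (intro M.a_lcomm) simp_all
  also have "\<dots> = x \<otimes> e"
    using assms by (simp add: M.r_neg)
  finally show ?thesis ..
qed

text \<open>
  The binomial theorem for right multiplication by \<open>e\<close> as the sum of the commuting operators of left
  multiplication by \<open>e\<close> and \<open>ad e\<close>. The induction moves the leftmost factor \<open>e\<close> of the power past \<open>x\<close>, so that the
  hypothesis is needed for \<open>ad e x\<close> as well as for \<open>x\<close>.
\<close>

lemma mult_power_binomial:
  assumes e: "e \<in> carrier H" and x: "x \<in> carrier H"
  shows "x \<otimes> e [^] n = (\<Oplus>i\<in>{..n}. [(n choose i)] \<cdot> (e [^] (n - i) \<otimes> (ad e ^^ i) x))"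
  using x
proof (induction n arbitrary: x)
  case 0
  then show ?case using e by simp
next
  case (Suc n)
  define y where "y i = e [^] (Suc n - i) \<otimes> (ad e ^^ i) x" for i
  have y: "y i \<in> carrier H" for i
    unfolding y_def using e Suc.prems by simp
  have power: "e [^] Suc k = e \<otimes> e [^] k" for k
    by (rule H.nat_pow_Suc2[OF e])
  have "x \<otimes> e [^] Suc n = (x \<otimes> e) \<otimes> e [^] n"
    unfolding power using e Suc.prems by (simp add: H.m_assoc)
  also have "\<dots> = e \<otimes> (x \<otimes> e [^] n) \<oplus> ad e x \<otimes> e [^] n"
    unfolding mult_eq_mult_ad[OF e Suc.prems] using e Suc.prems
    by (simp add: H.l_distr H.m_assoc)
  also have "e \<otimes> (x \<otimes> e [^] n) = (\<Oplus>i\<in>{..n}. [(n choose i)] \<cdot> y i)"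
  proof -
    have "e \<otimes> ([(n choose i)] \<cdot> (e [^] (n - i) \<otimes> (ad e ^^ i) x)) = [(n choose i)] \<cdot> y i"
      if "i \<le> n" for i
      unfolding y_def Suc_diff_le[OF that] power using e Suc.prems
      by (simp add: H.add_pow_rdistr H.m_assoc)
    then show ?thesis
      unfolding Suc.IH[OF Suc.prems] using e Suc.prems y
      by (subst H.finsum_rdistr) (auto intro!: M.finsum_cong')
  qed
  \<comment> \<open>The additional term vanishes; with it the sum can be shifted by one to match the other
    summand, and the coefficients add up by Pascal's rule.\<close>
  also have "\<dots> = (\<Oplus>i\<in>{..Suc n}. [(n choose i)] \<cdot> y i)"
    using y by (subst M.finsum_Suc) (auto simp: Pi_def binomial_eq_0)
  also have "\<dots> = (\<Oplus>i\<in>{..n}. [(n choose Suc i)] \<cdot> y (Suc i)) \<oplus> y 0"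
    using y by (subst M.finsum_Suc2) (auto simp: Pi_def)
  also have "ad e x \<otimes> e [^] n = (\<Oplus>i\<in>{..n}. [(n choose i)] \<cdot> y (Suc i))"
    using Suc.IH[of "ad e x"] e Suc.prems by (simp add: y_def funpow_swap1)
  also have "((\<Oplus>i\<in>{..n}. [(n choose Suc i)] \<cdot> y (Suc i)) \<oplus> y 0)
               \<oplus> (\<Oplus>i\<in>{..n}. [(n choose i)] \<cdot> y (Suc i))
      = (\<Oplus>i\<in>{..n}. [(n choose i)] \<cdot> y (Suc i) \<oplus> [(n choose Suc i)] \<cdot> y (Suc i)) \<oplus> y 0"
    using y by (subst M.finsum_addf) (auto simp: Pi_def M.a_ac)
  also have "\<dots> = (\<Oplus>i\<in>{..n}. [(Suc n choose Suc i)] \<cdot> y (Suc i)) \<oplus> [(Suc n choose 0)] \<cdot> y 0"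
    using y by (simp add: M.add.nat_pow_mult)
  also have "\<dots> = (\<Oplus>i\<in>{..Suc n}. [(Suc n choose i)] \<cdot> y i)"
    using y by (subst M.finsum_Suc2) (auto simp: Pi_def)
  finally show ?case
    unfolding y_def .
qed

lemma ad_smult:
  assumes "r \<in> carrier R" "e \<in> carrier H" "x \<in> carrier H"
  shows "ad e (r \<odot> x) = r \<odot> ad e x"
  using assms by (simp add: ad_def smult_mult_left smult_mult_right smult_minus_distr)

lemma ad_one_plus_smult:
  assumes "r \<in> carrier R" "f \<in> carrier H" "x \<in> carrier H"
  shows "ad (\<one> \<oplus> r \<odot> f) x = r \<odot> ad f x"
proof -
  have "ad (\<one> \<oplus> r \<odot> f) x = (x \<oplus> r \<odot> (x \<otimes> f)) \<ominus> (x \<oplus> r \<odot> (f \<otimes> x))"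
    using assms by (simp add: ad_def smult_mult_left smult_mult_right H.l_distr H.r_distr)
  also have "\<dots> = r \<odot> (x \<otimes> f) \<ominus> r \<odot> (f \<otimes> x)"
    using assms by (simp add: M.minus_eq M.minus_add M.a_ac M.r_neg2 M.r_neg1)
  finally show ?thesis
    using assms by (simp add: ad_def smult_minus_distr)
qed

text \<open>
  The first commutator contributes a factor \<open>r\<close> by assumption, and each of the \<open>i\<close> others contributes one because
  \<open>e\<close> is central modulo \<open>r\<close>. One factor is kept apart: it is the one that \<open>commutator_quotient\<close> divides by.
\<close>

lemma ad_funpow_eq_smult:
  assumes r: "r \<in> carrier R" and f: "f \<in> carrier H" and s: "s \<in> carrier H"
    and e: "e = \<one> \<oplus> r \<odot> f" and x: "ad e x = r \<odot> s"
  shows "(ad e ^^ Suc i) x = r \<odot> (r [^]\<^bsub>R\<^esub> i \<odot> (ad f ^^ i) s)"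
proof (induction i)
  case 0
  then show ?case using s by (simp add: x)
next
  case (Suc i)
  have "(ad e ^^ Suc (Suc i)) x = ad e (r \<odot> (r [^]\<^bsub>R\<^esub> i \<odot> (ad f ^^ i) s))"
    using Suc.IH by simp
  also have "\<dots> = r \<odot> (r [^]\<^bsub>R\<^esub> i \<odot> (r \<odot> ad f ((ad f ^^ i) s)))"
    unfolding e using r f s by (simp add: ad_smult ad_one_plus_smult)
  also have "\<dots> = r \<odot> (r [^]\<^bsub>R\<^esub> Suc i \<odot> (ad f ^^ Suc i) s)"
    using r f s by (simp add: smult_assoc1)
  finally show ?case .
qed

text \<open>
  This is \<open>D\<^sub>n\<close>: the quotient of \<open>x e\<^sup>n - e\<^sup>n x\<close> by \<open>r\<close>, as an explicit sum in which each term shows how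
  divisible it is. The sum omits \<open>i = 0\<close>, whose term \<open>e\<^sup>n x\<close> of the binomial expansion is moved to the other side
  to form the commutator.
\<close>

definition commutator_quotient :: "'r \<Rightarrow> 'h \<Rightarrow> nat \<Rightarrow> 'h \<Rightarrow> 'h" where
  "commutator_quotient r e n x =
     (\<Oplus>i\<in>{1..n}. [(n choose i)] \<cdot> (e [^] (n - i) \<otimes> divide_by r H ((ad e ^^ i) x)))"

lemma smult_commutator_quotient:
  assumes r: "r \<in> carrier R" "torsion_free_wrt r H" and f: "f \<in> carrier H" and s: "s \<in> carrier H"
    and e: "e = \<one> \<oplus> r \<odot> f" and x: "x \<in> carrier H" "ad e x = r \<odot> s"
  shows "r \<odot> commutator_quotient r e n x = ad (e [^] n) x"
proof -
  have e': "e \<in> carrier H"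
    using r f e by simp
  let ?y = "\<lambda>i. [(n choose i)] \<cdot> (e [^] (n - i) \<otimes> (ad e ^^ i) x)"
  have q: "divide_by r H ((ad e ^^ i) x) \<in> carrier H
      \<and> r \<odot> divide_by r H ((ad e ^^ i) x) = (ad e ^^ i) x" if "i \<in> {1..n}" for i
  proof -
    obtain j where "i = Suc j"
      using \<open>i \<in> {1..n}\<close> by (cases i) auto
    then show ?thesis
      using r f s
      by (simp add: ad_funpow_eq_smult[OF r(1) f s e x(2)] divide_by_smult del: funpow.simps)
  qed
  have move: "r \<odot> ([k] \<cdot> (a \<otimes> b)) = [k] \<cdot> (a \<otimes> (r \<odot> b))"
    if "a \<in> carrier H" "b \<in> carrier H" for a b and k :: nat
    using r that smult_left_commute[of r "[k] \<cdot>\<^bsub>R\<^esub> \<one>\<^bsub>R\<^esub>" "a \<otimes> b"]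
    by (simp add: add_pow_eq_smult smult_mult_right)
  have quotient: "r \<odot> commutator_quotient r e n x = (\<Oplus>i\<in>{1..n}. ?y i)"
    unfolding commutator_quotient_def using r e' x q
    by (subst finsum_smult_ldistr) (auto intro!: M.finsum_cong' simp: move)
  have binomial: "x \<otimes> e [^] n = e [^] n \<otimes> x \<oplus> (\<Oplus>i\<in>{1..n}. ?y i)"
    unfolding mult_power_binomial[OF e' x(1)]
    using e' x by (subst M.add.finprod_0'[symmetric]) (auto simp: Pi_def)
  have closed: "(\<Oplus>i\<in>{1..n}. ?y i) \<in> carrier H"
    using e' x by (intro M.finsum_closed) (auto simp: Pi_def)
  have "e [^] n \<otimes> x \<oplus> (\<Oplus>i\<in>{1..n}. ?y i) = e [^] n \<otimes> x \<oplus> ad (e [^] n) x"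
    using e' x binomial mult_eq_mult_ad[of "e [^] n" x] by simp
  then have "(\<Oplus>i\<in>{1..n}. ?y i) = ad (e [^] n) x"
    using e' x closed by (subst (asm) M.add.l_cancel) simp_all
  then show ?thesis
    using quotient by simp
qed

text \<open>
  Already each term of the sum is divisible: for \<open>r = p t\<close>, the \<open>i\<close>-th term is the integer
  \<open>(n choose i) * p\<^sup>i\<^sup>-\<^sup>1\<close> times \<open>t\<^sup>i\<^sup>-\<^sup>1\<close> times an element of \<open>H\<close>.
\<close>

lemma commutator_quotient_divisible:
  assumes r: "r \<in> carrier R" "torsion_free_wrt r H" and f: "f \<in> carrier H" and s: "s \<in> carrier H"
    and e: "e = \<one> \<oplus> r \<odot> f" and x: "x \<in> carrier H" "ad e x = r \<odot> s"
    and p: "Factorial_Ring.prime p" "([p] \<cdot>\<^bsub>R\<^esub> \<one>\<^bsub>R\<^esub>) divides\<^bsub>R\<^esub> r"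
  shows "\<exists>y\<in>carrier H. [(p ^ multiplicity p n)] \<cdot> y = commutator_quotient r e n x"
proof -
  let ?v = "p ^ multiplicity p n"
  have e': "e \<in> carrier H"
    using r f e by simp
  obtain t where t: "t \<in> carrier R" "r = ([p] \<cdot>\<^bsub>R\<^esub> \<one>\<^bsub>R\<^esub>) \<otimes>\<^bsub>R\<^esub> t"
    using p(2) by (auto simp: factor_def)
  have "\<exists>y\<in>carrier H. ([?v] \<cdot>\<^bsub>R\<^esub> \<one>\<^bsub>R\<^esub>) \<odot> y
      = [(n choose i)] \<cdot> (e [^] (n - i) \<otimes> divide_by r H ((ad e ^^ i) x))" if i: "i \<in> {1..n}" for i
  proof -
    obtain j where j: "i = Suc j"
      using i by (cases i) auto
    obtain k where k: "(n choose i) * p ^ j = ?v * k"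
      using prime_power_dvd_binomial_times_power[OF p(1), of i n] i j by (auto elim: dvdE)
    define z where "z = e [^] (n - i) \<otimes> (ad f ^^ j) s"
    have z: "z \<in> carrier H"
      using e' f s by (simp add: z_def)
    have "divide_by r H ((ad e ^^ i) x) = r [^]\<^bsub>R\<^esub> j \<odot> (ad f ^^ j) s"
      unfolding j ad_funpow_eq_smult[OF r(1) f s e x(2)] using r f s by (simp add: divide_by_smult)
    then have "[(n choose i)] \<cdot> (e [^] (n - i) \<otimes> divide_by r H ((ad e ^^ i) x))
        = (([(n choose i)] \<cdot>\<^bsub>R\<^esub> \<one>\<^bsub>R\<^esub>) \<otimes>\<^bsub>R\<^esub> r [^]\<^bsub>R\<^esub> j) \<odot> z"
      using e' f s r by (simp add: z_def add_pow_eq_smult smult_mult_right smult_assoc1)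
    also have "([(n choose i)] \<cdot>\<^bsub>R\<^esub> \<one>\<^bsub>R\<^esub>) \<otimes>\<^bsub>R\<^esub> r [^]\<^bsub>R\<^esub> j
        = ([((n choose i) * p ^ j)] \<cdot>\<^bsub>R\<^esub> \<one>\<^bsub>R\<^esub>) \<otimes>\<^bsub>R\<^esub> t [^]\<^bsub>R\<^esub> j"
      using t by (simp only: t(2) R.add_pow_one_mult R.add_pow_one_power R.nat_pow_distrib
          R.add.nat_pow_closed R.one_closed R.m_assoc R.nat_pow_closed)
    also have "\<dots> = ([?v] \<cdot>\<^bsub>R\<^esub> \<one>\<^bsub>R\<^esub>) \<otimes>\<^bsub>R\<^esub> (([k] \<cdot>\<^bsub>R\<^esub> \<one>\<^bsub>R\<^esub>) \<otimes>\<^bsub>R\<^esub> t [^]\<^bsub>R\<^esub> j)"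
      unfolding k using t by (simp only: R.add_pow_one_mult R.add.nat_pow_closed R.one_closed
          R.m_assoc R.nat_pow_closed)
    finally show ?thesis
      using t z by (intro bexI[of _ "(([k] \<cdot>\<^bsub>R\<^esub> \<one>\<^bsub>R\<^esub>) \<otimes>\<^bsub>R\<^esub> t [^]\<^bsub>R\<^esub> j) \<odot> z"]) (simp_all add: smult_assoc1)
  qed
  then obtain y where y: "\<And>i. i \<in> {1..n} \<Longrightarrow> y i \<in> carrier H"
    "\<And>i. i \<in> {1..n} \<Longrightarrow> ([?v] \<cdot>\<^bsub>R\<^esub> \<one>\<^bsub>R\<^esub>) \<odot> y i
      = [(n choose i)] \<cdot> (e [^] (n - i) \<otimes> divide_by r H ((ad e ^^ i) x))"
    by metis
  have "commutator_quotient r e n x = (\<Oplus>i\<in>{1..n}. ([?v] \<cdot>\<^bsub>R\<^esub> \<one>\<^bsub>R\<^esub>) \<odot> y i)"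
    unfolding commutator_quotient_def using y by (intro M.finsum_cong') auto
  also have "\<dots> = [?v] \<cdot> (\<Oplus>i\<in>{1..n}. y i)"
    using y by (simp add: add_pow_eq_smult finsum_smult_ldistr M.finsum_closed Pi_def)
  finally show ?thesis
    using y by (intro bexI[of _ "\<Oplus>i\<in>{1..n}. y i"]) auto
qed

lemma ad_add:
  assumes "e \<in> carrier H" "x \<in> carrier H" "y \<in> carrier H"
  shows "ad e (x \<oplus> y) = ad e x \<oplus> ad e y"
  using assms by (simp add: ad_def M.minus_eq H.l_distr H.r_distr M.minus_add M.a_ac)

lemma ad_mult:
  assumes "e \<in> carrier H" "x \<in> carrier H" "y \<in> carrier H"
  shows "ad e (x \<otimes> y) = x \<otimes> ad e y \<oplus> ad e x \<otimes> y"
proof -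
  have "x \<otimes> ad e y \<oplus> ad e x \<otimes> y = x \<otimes> (y \<otimes> e) \<oplus> (\<ominus> (x \<otimes> (e \<otimes> y)) \<oplus> (x \<otimes> (e \<otimes> y) \<oplus> \<ominus> (e \<otimes> (x \<otimes> y))))"
    using assms by (simp add: ad_def M.minus_eq H.l_distr H.r_distr H.l_minus H.r_minus H.m_assoc M.a_assoc)
  also have "\<dots> = ad e (x \<otimes> y)"
    using assms by (simp add: ad_def M.minus_eq M.r_neg1 H.m_assoc)
  finally show ?thesis ..
qed

text \<open>
  Every identity required of \<open>\<phi>\<close> holds after multiplication by \<open>c\<close>, where it becomes an identity for the
  derivation \<open>ad e\<close>. It is stated for any homomorphism \<open>\<iota>\<close> from \<open>A\<close>, through which \<open>A\<close> acts on \<open>H\<close> from both sides.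
\<close>

lemma divided_inner_derivation_cocycle:
  fixes A :: "('r, 'a) module" and \<iota> :: "'a \<Rightarrow> 'h"
  assumes c: "c \<in> carrier R" "torsion_free_wrt c H" and e: "e \<in> carrier H"
    and A: "algebra R A"
    and \<iota>: "\<And>a. a \<in> carrier A \<Longrightarrow> \<iota> a \<in> carrier H"
    and \<iota>_add: "\<And>a b. \<lbrakk>a \<in> carrier A; b \<in> carrier A\<rbrakk> \<Longrightarrow> \<iota> (a \<oplus>\<^bsub>A\<^esub> b) = \<iota> a \<oplus> \<iota> b"
    and \<iota>_smult: "\<And>r a. \<lbrakk>r \<in> carrier R; a \<in> carrier A\<rbrakk> \<Longrightarrow> \<iota> (r \<odot>\<^bsub>A\<^esub> a) = r \<odot> \<iota> a"
    and \<iota>_mult: "\<And>a b. \<lbrakk>a \<in> carrier A; b \<in> carrier A\<rbrakk> \<Longrightarrow> \<iota> (a \<otimes>\<^bsub>A\<^esub> b) = \<iota> a \<otimes> \<iota> b"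
    and \<phi>: "\<And>a. a \<in> carrier A \<Longrightarrow> \<phi> a \<in> carrier H"
    and \<phi>_eq: "\<And>a. a \<in> carrier A \<Longrightarrow> c \<odot> \<phi> a = ad e (\<iota> a)"
  shows "hochschild_1_cocycle R A H (\<lambda>a b. \<iota> a \<otimes> b) (\<lambda>b a. b \<otimes> \<iota> a) \<phi>"
proof -
  interpret A: algebra R A by (rule A)
  note cancel = torsion_free_cancel[OF c(2,1)]
  have add: "\<phi> (a \<oplus>\<^bsub>A\<^esub> b) = \<phi> a \<oplus> \<phi> b" if "a \<in> carrier A" "b \<in> carrier A" for a b
    by (rule cancel) (use that c e in \<open>simp_all add: \<phi> \<phi>_eq \<iota> \<iota>_add ad_add smult_r_distr\<close>)
  have smult: "\<phi> (r \<odot>\<^bsub>A\<^esub> a) = r \<odot> \<phi> a" if "r \<in> carrier R" "a \<in> carrier A" for r a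
  proof (rule cancel)
    have "c \<odot> (r \<odot> \<phi> a) = r \<odot> (c \<odot> \<phi> a)"
      using that c by (simp add: \<phi> smult_assoc1[symmetric] R.m_comm)
    then show "c \<odot> \<phi> (r \<odot>\<^bsub>A\<^esub> a) = c \<odot> (r \<odot> \<phi> a)"
      using that e by (simp add: \<phi>_eq \<iota> \<iota>_smult ad_smult)
  qed (use that in \<open>simp_all add: \<phi>\<close>)
  have mult: "\<phi> (a \<otimes>\<^bsub>A\<^esub> b) = \<iota> a \<otimes> \<phi> b \<oplus> \<phi> a \<otimes> \<iota> b" if "a \<in> carrier A" "b \<in> carrier A" for a b
  proof (rule cancel)
    have "c \<odot> (\<iota> a \<otimes> \<phi> b \<oplus> \<phi> a \<otimes> \<iota> b) = \<iota> a \<otimes> (c \<odot> \<phi> b) \<oplus> (c \<odot> \<phi> a) \<otimes> \<iota> b"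
      using that c by (simp add: \<phi> \<iota> smult_r_distr smult_mult_left smult_mult_right)
    then show "c \<odot> \<phi> (a \<otimes>\<^bsub>A\<^esub> b) = c \<odot> (\<iota> a \<otimes> \<phi> b \<oplus> \<phi> a \<otimes> \<iota> b)"
      using that e by (simp add: \<phi>_eq \<iota> \<iota>_mult ad_mult)
  qed (use that in \<open>simp_all add: \<phi> \<iota>\<close>)
  have "(\<iota> a \<otimes> \<phi> b \<ominus> \<phi> (a \<otimes>\<^bsub>A\<^esub> b)) \<oplus> \<phi> a \<otimes> \<iota> b = \<zero>" if "a \<in> carrier A" "b \<in> carrier A" for a b
    using that by (simp add: mult \<phi> \<iota> M.minus_eq M.minus_add M.r_neg M.r_neg1 M.r_neg2 M.l_neg M.a_ac)
  then show ?thesis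
    using add smult \<phi> by (auto simp: hochschild_1_cocycle_def)
qed

end

section \<open>The endomorphism algebra of a module\<close>

lemma carrier_module_Hom:
  "carrier (module_Hom R M) = {f \<in> carrier M \<rightarrow>\<^sub>E carrier M.
     (\<forall>x\<in>carrier M. \<forall>y\<in>carrier M. f (x \<oplus>\<^bsub>M\<^esub> y) = f x \<oplus>\<^bsub>M\<^esub> f y) \<and>
     (\<forall>r\<in>carrier R. \<forall>x\<in>carrier M. f (r \<odot>\<^bsub>M\<^esub> x) = r \<odot>\<^bsub>M\<^esub> f x)}"
  by (simp add: module_Hom_def)

lemma module_Hom_simps:
  "f \<otimes>\<^bsub>module_Hom R M\<^esub> g = (\<lambda>x\<in>carrier M. f (g x))"
  "\<one>\<^bsub>module_Hom R M\<^esub> = (\<lambda>x\<in>carrier M. x)"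
  "f \<oplus>\<^bsub>module_Hom R M\<^esub> g = (\<lambda>x\<in>carrier M. f x \<oplus>\<^bsub>M\<^esub> g x)"
  "\<zero>\<^bsub>module_Hom R M\<^esub> = (\<lambda>x\<in>carrier M. \<zero>\<^bsub>M\<^esub>)"
  "r \<odot>\<^bsub>module_Hom R M\<^esub> f = (\<lambda>x\<in>carrier M. r \<odot>\<^bsub>M\<^esub> f x)"
  by (simp_all add: module_Hom_def compose_def)

context
  fixes R :: "'r ring" and M :: "('r, 'm) module"
  assumes M: "module R M"
begin

interpretation module R M by (rule M)

lemma module_Hom_apply [simp]:
  assumes "x \<in> carrier M"
  shows "(f \<otimes>\<^bsub>module_Hom R M\<^esub> g) x = f (g x)"
    and "\<one>\<^bsub>module_Hom R M\<^esub> x = x"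
    and "(f \<oplus>\<^bsub>module_Hom R M\<^esub> g) x = f x \<oplus>\<^bsub>M\<^esub> g x"
    and "\<zero>\<^bsub>module_Hom R M\<^esub> x = \<zero>\<^bsub>M\<^esub>"
    and "(r \<odot>\<^bsub>module_Hom R M\<^esub> f) x = r \<odot>\<^bsub>M\<^esub> f x"
  using assms by (simp_all add: module_Hom_simps)

lemma module_Hom_closed [simp]:
  "\<lbrakk>f \<in> carrier (module_Hom R M); x \<in> carrier M\<rbrakk> \<Longrightarrow> f x \<in> carrier M"
  unfolding carrier_module_Hom by blast

lemma module_Hom_add [simp]:
  "\<lbrakk>f \<in> carrier (module_Hom R M); x \<in> carrier M; y \<in> carrier M\<rbrakk>
     \<Longrightarrow> f (x \<oplus>\<^bsub>M\<^esub> y) = f x \<oplus>\<^bsub>M\<^esub> f y"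
  unfolding carrier_module_Hom by blast

lemma module_Hom_smult [simp]:
  "\<lbrakk>f \<in> carrier (module_Hom R M); r \<in> carrier R; x \<in> carrier M\<rbrakk>
     \<Longrightarrow> f (r \<odot>\<^bsub>M\<^esub> x) = r \<odot>\<^bsub>M\<^esub> f x"
  unfolding carrier_module_Hom by blast

lemma module_Hom_eqI:
  assumes "f \<in> carrier (module_Hom R M)" "g \<in> carrier (module_Hom R M)"
    and "\<And>x. x \<in> carrier M \<Longrightarrow> f x = g x"
  shows "f = g"
proof (rule PiE_ext)
  show "f \<in> carrier M \<rightarrow>\<^sub>E carrier M" "g \<in> carrier M \<rightarrow>\<^sub>E carrier M"
    using assms(1,2) unfolding carrier_module_Hom by blast+
qed (rule assms(3))

lemma restrict_in_module_Hom:
  assumes "\<And>x. x \<in> carrier M \<Longrightarrow> f x \<in> carrier M"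
    and "\<And>x y. \<lbrakk>x \<in> carrier M; y \<in> carrier M\<rbrakk> \<Longrightarrow> f (x \<oplus>\<^bsub>M\<^esub> y) = f x \<oplus>\<^bsub>M\<^esub> f y"
    and "\<And>r x. \<lbrakk>r \<in> carrier R; x \<in> carrier M\<rbrakk> \<Longrightarrow> f (r \<odot>\<^bsub>M\<^esub> x) = r \<odot>\<^bsub>M\<^esub> f x"
  shows "restrict f (carrier M) \<in> carrier (module_Hom R M)"
  unfolding carrier_module_Hom
proof (intro CollectI conjI ballI)
  show "restrict f (carrier M) \<in> carrier M \<rightarrow>\<^sub>E carrier M"
    by (simp add: PiE_iff assms(1))
qed (simp_all add: assms(2,3))

lemma module_Hom_op_closed [simp]:
  "\<lbrakk>f \<in> carrier (module_Hom R M); g \<in> carrier (module_Hom R M)\<rbrakk>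
     \<Longrightarrow> f \<otimes>\<^bsub>module_Hom R M\<^esub> g \<in> carrier (module_Hom R M)"
  "\<one>\<^bsub>module_Hom R M\<^esub> \<in> carrier (module_Hom R M)"
  "\<lbrakk>f \<in> carrier (module_Hom R M); g \<in> carrier (module_Hom R M)\<rbrakk>
     \<Longrightarrow> f \<oplus>\<^bsub>module_Hom R M\<^esub> g \<in> carrier (module_Hom R M)"
  "\<zero>\<^bsub>module_Hom R M\<^esub> \<in> carrier (module_Hom R M)"
  "\<lbrakk>r \<in> carrier R; f \<in> carrier (module_Hom R M)\<rbrakk>
     \<Longrightarrow> r \<odot>\<^bsub>module_Hom R M\<^esub> f \<in> carrier (module_Hom R M)"
  unfolding module_Hom_simps
  by (rule restrict_in_module_Hom; simp add: M.a_ac smult_r_distr smult_left_commute)+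

text \<open>
  Multiplication by the scalar \<open>-1\<close> provides the additive inverses.
\<close>

lemma abelian_group_module_Hom: "abelian_group (module_Hom R M)"
proof (rule abelian_groupI)
  fix f assume f: "f \<in> carrier (module_Hom R M)"
  have "(\<ominus>\<^bsub>R\<^esub> \<one>\<^bsub>R\<^esub>) \<odot>\<^bsub>module_Hom R M\<^esub> f \<oplus>\<^bsub>module_Hom R M\<^esub> f = \<zero>\<^bsub>module_Hom R M\<^esub>"
    using f by (intro module_Hom_eqI) (simp_all add: smult_l_minus M.l_neg)
  then show "\<exists>g\<in>carrier (module_Hom R M). g \<oplus>\<^bsub>module_Hom R M\<^esub> f = \<zero>\<^bsub>module_Hom R M\<^esub>"
    using f by (intro bexI[of _ "(\<ominus>\<^bsub>R\<^esub> \<one>\<^bsub>R\<^esub>) \<odot>\<^bsub>module_Hom R M\<^esub> f"]) simp_all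
qed (auto intro!: module_Hom_eqI simp: M.a_ac)

lemma assoc_algebra_module_Hom: "assoc_algebra R (module_Hom R M)"
proof -
  have "module R (module_Hom R M)"
    by (rule moduleI[OF R.is_cring abelian_group_module_Hom])
       (auto intro!: module_Hom_eqI
          simp: smult_l_distr smult_r_distr smult_assoc1)
  moreover have "ring (module_Hom R M)"
  proof (rule ringI[OF abelian_group_module_Hom])
    show "monoid (module_Hom R M)"
      by (rule monoidI) (auto intro!: module_Hom_eqI)
  qed (auto intro!: module_Hom_eqI)
  moreover have "assoc_algebra_axioms R (module_Hom R M)"
    by unfold_locales (auto intro!: module_Hom_eqI)
  ultimately show ?thesis
    by (simp add: assoc_algebra_def)
qed

lemma torsion_free_module_Hom:
  assumes "torsion_free_wrt r M"
  shows "torsion_free_wrt r (module_Hom R M)"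
  unfolding torsion_free_wrt_def
proof safe
  fix f assume f: "f \<in> carrier (module_Hom R M)"
    and eq: "r \<odot>\<^bsub>module_Hom R M\<^esub> f = \<zero>\<^bsub>module_Hom R M\<^esub>"
  have *: "r \<odot>\<^bsub>M\<^esub> f x = \<zero>\<^bsub>M\<^esub>" if "x \<in> carrier M" for x
    using fun_cong[OF eq, of x] that by simp
  have "f x = \<zero>\<^bsub>M\<^esub>" if "x \<in> carrier M" for x
    by (rule torsion_freeD[OF M assms]) (use f that * in simp_all)
  then show "f = \<zero>\<^bsub>module_Hom R M\<^esub>"
    using f by (intro module_Hom_eqI) auto
qed

end

section \<open>Multiplication by \<open>E\<close> and the action of \<open>A\<close>\<close>

text \<open>
  The congruence \<open>E \<equiv> 1\<close> in \<open>M\<close> turns into the congruence \<open>e \<equiv> 1\<close> in the endomorphism algebra, with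
  multiplication by \<open>z\<close> in the place of \<open>f\<close>.
\<close>

lemma mult_map_one_plus_smult:
  assumes M: "algebra R M" and z: "z \<in> carrier M" and r: "r \<in> carrier R"
  shows "mult_map M z \<in> carrier (module_Hom R M)"
    and "mult_map M (\<one>\<^bsub>M\<^esub> \<oplus>\<^bsub>M\<^esub> r \<odot>\<^bsub>M\<^esub> z)
      = \<one>\<^bsub>module_Hom R M\<^esub> \<oplus>\<^bsub>module_Hom R M\<^esub> r \<odot>\<^bsub>module_Hom R M\<^esub> mult_map M z"
proof -
  interpret algebra R M by (rule M)
  have "z \<otimes>\<^bsub>M\<^esub> (a \<odot>\<^bsub>M\<^esub> x) = a \<odot>\<^bsub>M\<^esub> (z \<otimes>\<^bsub>M\<^esub> x)"
    if "a \<in> carrier R" "x \<in> carrier M" for a x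
    using z that by (metis m_comm smult_assoc2 smult_closed)
  then show "mult_map M z \<in> carrier (module_Hom R M)"
    unfolding mult_map_def using z by (intro restrict_in_module_Hom[OF module]) (auto simp: r_distr)
  show "mult_map M (\<one>\<^bsub>M\<^esub> \<oplus>\<^bsub>M\<^esub> r \<odot>\<^bsub>M\<^esub> z)
      = \<one>\<^bsub>module_Hom R M\<^esub> \<oplus>\<^bsub>module_Hom R M\<^esub> r \<odot>\<^bsub>module_Hom R M\<^esub> mult_map M z"
    using z r by (auto simp: mult_map_def module_Hom_simps l_distr smult_assoc2)
qed

text \<open>
  The scalars of \<open>R\<close> act on \<open>M\<close> as elements of \<open>A\<close>, namely as the multiples of \<open>1\<close>. They commute with all of \<open>A\<close>,
  which is why \<open>A\<close> acts by \<open>R\<close>-linear maps.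
\<close>

lemma action_map_algebra_hom:
  assumes A: "algebra R A" and M: "module R M" and act: "compatible_left_module R A M act"
    and a: "a \<in> carrier A"
  shows "action_map M act a \<in> carrier (module_Hom R M)"
    and "b \<in> carrier A \<Longrightarrow> action_map M act (a \<oplus>\<^bsub>A\<^esub> b)
           = action_map M act a \<oplus>\<^bsub>module_Hom R M\<^esub> action_map M act b"
    and "r \<in> carrier R \<Longrightarrow> action_map M act (r \<odot>\<^bsub>A\<^esub> a) = r \<odot>\<^bsub>module_Hom R M\<^esub> action_map M act a"
    and "b \<in> carrier A \<Longrightarrow> action_map M act (a \<otimes>\<^bsub>A\<^esub> b)
           = action_map M act a \<otimes>\<^bsub>module_Hom R M\<^esub> action_map M act b"
proof -
  interpret A: algebra R A by (rule A)
  interpret M: module R M by (rule M)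
  have mod: "module A (with_action M act)"
    and compat: "\<And>r a m. \<lbrakk>r \<in> carrier R; a \<in> carrier A; m \<in> carrier M\<rbrakk>
      \<Longrightarrow> act (r \<odot>\<^bsub>A\<^esub> a) m = r \<odot>\<^bsub>M\<^esub> act a m"
    using act by (auto simp: compatible_left_module_def)
  have closed: "act a m \<in> carrier M" if "a \<in> carrier A" "m \<in> carrier M" for a m
    using module.smult_closed[OF mod, of a m] that by (simp add: with_action_def)
  have l_distr: "act (a \<oplus>\<^bsub>A\<^esub> b) m = act a m \<oplus>\<^bsub>M\<^esub> act b m"
    if "a \<in> carrier A" "b \<in> carrier A" "m \<in> carrier M" for a b m
    using module.smult_l_distr[OF mod, of a b m] that by (simp add: with_action_def)
  have r_distr: "act a (l \<oplus>\<^bsub>M\<^esub> m) = act a l \<oplus>\<^bsub>M\<^esub> act a m"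
    if "a \<in> carrier A" "l \<in> carrier M" "m \<in> carrier M" for a l m
    using module.smult_r_distr[OF mod, of a l m] that by (simp add: with_action_def)
  have assoc: "act (a \<otimes>\<^bsub>A\<^esub> b) m = act a (act b m)"
    if "a \<in> carrier A" "b \<in> carrier A" "m \<in> carrier M" for a b m
    using module.smult_assoc1[OF mod, of a b m] that by (simp add: with_action_def)
  have one: "act \<one>\<^bsub>A\<^esub> m = m" if "m \<in> carrier M" for m
    using module.smult_one[OF mod, of m] that by (simp add: with_action_def)
  have "act a (r \<odot>\<^bsub>M\<^esub> m) = r \<odot>\<^bsub>M\<^esub> act a m" if r: "r \<in> carrier R" and m: "m \<in> carrier M" for r m
  proof -
    have "r \<odot>\<^bsub>M\<^esub> m = act (r \<odot>\<^bsub>A\<^esub> \<one>\<^bsub>A\<^esub>) m"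
      using r m by (simp add: compat one)
    then have "act a (r \<odot>\<^bsub>M\<^esub> m) = act (a \<otimes>\<^bsub>A\<^esub> (r \<odot>\<^bsub>A\<^esub> \<one>\<^bsub>A\<^esub>)) m"
      using a r m by (simp add: assoc)
    also have "a \<otimes>\<^bsub>A\<^esub> (r \<odot>\<^bsub>A\<^esub> \<one>\<^bsub>A\<^esub>) = r \<odot>\<^bsub>A\<^esub> a"
      using a r by (subst A.m_comm) (simp_all add: A.smult_assoc2)
    finally show ?thesis
      using a r m by (simp add: compat)
  qed
  then show "action_map M act a \<in> carrier (module_Hom R M)"
    unfolding action_map_def using a closed r_distr by (intro restrict_in_module_Hom[OF M]) auto
  show "b \<in> carrier A \<Longrightarrow> action_map M act (a \<oplus>\<^bsub>A\<^esub> b)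
           = action_map M act a \<oplus>\<^bsub>module_Hom R M\<^esub> action_map M act b"
    and "r \<in> carrier R \<Longrightarrow> action_map M act (r \<odot>\<^bsub>A\<^esub> a) = r \<odot>\<^bsub>module_Hom R M\<^esub> action_map M act a"
    and "b \<in> carrier A \<Longrightarrow> action_map M act (a \<otimes>\<^bsub>A\<^esub> b)
           = action_map M act a \<otimes>\<^bsub>module_Hom R M\<^esub> action_map M act b"
    using a closed
    by (auto simp: module_Hom_simps action_map_def l_distr assoc compat)
qed

section \<open>The cocycle\<close>

theorem mainTheorem8:
  fixes R :: "'r ring"
    and A :: "('r, 'a) module"
    and M :: "('r, 'm) module"
    and act :: "'a \<Rightarrow> 'm \<Rightarrow> 'm"
    and \<mu> :: 'r and E :: 'm
    and n p :: nat
  assumes "cring R"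
    and "algebra R A"
    and "algebra R M"
    and "compatible_left_module R A M act"
    and "\<mu> \<in> carrier R"
    and "E \<in> carrier M"
    and "torsion_free_wrt \<mu> M"
    and "congruent_modulo \<mu> M E \<one>\<^bsub>M\<^esub>"
    and "\<forall>T\<in>carrier A. congruent_modulo \<mu> (module_Hom R M)
           (action_map M act T \<otimes>\<^bsub>module_Hom R M\<^esub> mult_map M E)
           (mult_map M E \<otimes>\<^bsub>module_Hom R M\<^esub> action_map M act T)"
    and "n > 0"
    and "Factorial_Ring.prime p"
    and "([p] \<cdot>\<^bsub>R\<^esub> \<one>\<^bsub>R\<^esub>) divides\<^bsub>R\<^esub> \<mu>"
  shows "hochschild_1_cocycle R A (module_Hom R M) (post_comp R M act) (pre_comp R M act)
           (\<lambda>T. Delta R M act \<mu> E p n T)"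
proof -
  interpret M: algebra R M by fact
  interpret H: assoc_algebra R "module_Hom R M" by (rule assoc_algebra_module_Hom[OF M.module])
  let ?H = "module_Hom R M"
  let ?v = "p ^ multiplicity p n"
  let ?c = "[?v] \<cdot>\<^bsub>R\<^esub> \<one>\<^bsub>R\<^esub>"
  let ?\<iota> = "action_map M act"
  note hom = action_map_algebra_hom[OF assms(2) M.module assms(4)]
  obtain z where z: "z \<in> carrier M" "E \<ominus>\<^bsub>M\<^esub> \<one>\<^bsub>M\<^esub> = \<mu> \<odot>\<^bsub>M\<^esub> z"
    using assms(8) by (auto simp: congruent_modulo_def)
  have "E = \<one>\<^bsub>M\<^esub> \<oplus>\<^bsub>M\<^esub> (E \<ominus>\<^bsub>M\<^esub> \<one>\<^bsub>M\<^esub>)"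
    using assms(6) by (simp add: M.minus_eq M.a_lcomm M.r_neg)
  then have E: "mult_map M E = \<one>\<^bsub>?H\<^esub> \<oplus>\<^bsub>?H\<^esub> \<mu> \<odot>\<^bsub>?H\<^esub> mult_map M z"
    using mult_map_one_plus_smult(2)[OF assms(3) z(1) assms(5)] z(2) by simp
  have e: "mult_map M E \<in> carrier ?H" and f: "mult_map M z \<in> carrier ?H"
    using mult_map_one_plus_smult(1)[OF assms(3)] assms(5,6) z(1) by blast+
  have mu: "torsion_free_wrt \<mu> ?H"
    using assms(7) by (rule torsion_free_module_Hom[OF M.module])
  have c: "torsion_free_wrt ?c ?H"
    unfolding M.R.add_pow_one_power
    by (intro H.torsion_free_power H.torsion_free_divides[OF mu assms(12)]) simp_all
  have D: "D_op R M act \<mu> E n T = H.commutator_quotient \<mu> (mult_map M E) n (?\<iota> T)" for T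
  proof -
    have "mu_delta R M E = H.ad (mult_map M E)"
      by (simp add: fun_eq_iff mu_delta_def H.ad_def)
    then show ?thesis
      by (simp add: D_op_def H.commutator_quotient_def)
  qed
  have Delta: "Delta R M act \<mu> E p n T \<in> carrier ?H
      \<and> (\<mu> \<otimes>\<^bsub>R\<^esub> ?c) \<odot>\<^bsub>?H\<^esub> Delta R M act \<mu> E p n T = H.ad (mult_map M E [^]\<^bsub>?H\<^esub> n) (?\<iota> T)"
    if T: "T \<in> carrier A" for T
  proof -
    obtain s where s: "s \<in> carrier ?H" "H.ad (mult_map M E) (?\<iota> T) = \<mu> \<odot>\<^bsub>?H\<^esub> s"
      using assms(9) T by (auto simp: congruent_modulo_def H.ad_def)
    note facts = assms(5) mu f s(1) E hom(1)[OF T] s(2)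
    obtain X where X: "X \<in> carrier ?H" "[?v] \<cdot>\<^bsub>?H\<^esub> X = D_op R M act \<mu> E n T"
      using H.commutator_quotient_divisible[OF facts assms(11,12)] unfolding D by blast
    have "Delta R M act \<mu> E p n T = X"
      unfolding Delta_def
    proof (rule the_equality)
      fix Y assume "Y \<in> carrier ?H \<and> [?v] \<cdot>\<^bsub>?H\<^esub> Y = D_op R M act \<mu> E n T"
      then show "Y = X"
        by (intro H.torsion_free_cancel[OF c, of Y X]) (use X in \<open>auto simp: H.add_pow_eq_smult\<close>)
    qed (use X in simp)
    moreover have "(\<mu> \<otimes>\<^bsub>R\<^esub> ?c) \<odot>\<^bsub>?H\<^esub> X = \<mu> \<odot>\<^bsub>?H\<^esub> D_op R M act \<mu> E n T"
      using X assms(5) by (simp add: H.smult_assoc1 H.add_pow_eq_smult[symmetric])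
    ultimately show ?thesis
      using X(1) H.smult_commutator_quotient[OF facts] by (simp add: D)
  qed
  have "hochschild_1_cocycle R A ?H (\<lambda>a b. ?\<iota> a \<otimes>\<^bsub>?H\<^esub> b) (\<lambda>b a. b \<otimes>\<^bsub>?H\<^esub> ?\<iota> a)
      (\<lambda>T. Delta R M act \<mu> E p n T)"
    using assms(2,5) mu c e hom Delta
    by (intro H.divided_inner_derivation_cocycle[where c = "\<mu> \<otimes>\<^bsub>R\<^esub> ?c"
          and e = "mult_map M E [^]\<^bsub>?H\<^esub> n"] H.torsion_free_mult) auto
  then show ?thesis
    by (simp add: post_comp_def pre_comp_def hochschild_1_cocycle_def)
qed

end
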